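(* There is a deterministic online algorithm for the generalized $k$-server problem on weighted uniform metrics with competitive ratio at most $2^{2^{k+3}}$.
   Context: Generalized $k$-server problem: there are $k$ servers $s_1,\dots,s_k$, where server $s_i$ lies in its own metric space $M_i$. Requests arrive online; a request is a $k$-tuple $r=(r_1,\dots,r_k)$ with $r_i\in M_i$, and to serve it the algorithm must move servers so that $s_i$ is at $r_i$ for at least one $i$. The cost is the total distance traveled by all servers. Weighted uniform metric case: each $M_i$ is a uniform metric space in which all pairwise distances equal some $w_i>0$ (the weights $w_i$ may differ across $i$). An online algorithm is $c$-competitive if there is a constant $a$ independent of the request sequence such that for every request sequence $\sigma$, $\mathrm{cost}_{\mathrm{ALG}}(\sigma)\le c\cdot\mathrm{OPT}(\sigma)+a$, with $\mathrm{OPT}(\sigma)$ the optimal offline cost. *)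

theory Defs
  imports "HOL-Analysis.Abstract_Metric_Spaces"
begin

definition uniform_metric_space :: "'a set \<Rightarrow> ('a \<Rightarrow> 'a \<Rightarrow> real) \<Rightarrow> real \<Rightarrow> bool" where
  "uniform_metric_space X d w \<longleftrightarrow>
     Metric_space X d \<and> 0 < w \<and> (\<forall>x\<in>X. \<forall>y\<in>X. x \<noteq> y \<longrightarrow> d x y = w)"

(* Servers are indexed by 0, ..., k - 1, and server i lives in the space with carrier M i and
   distance d i.  All carriers lie in one type 'a; disjoint spaces embed via a sum type.
   Requests are k-tuples of the same shape as configurations. *)
definition configs :: "nat \<Rightarrow> (nat \<Rightarrow> 'a set) \<Rightarrow> (nat \<Rightarrow> 'a) set" where
  "configs k M = PiE {..<k} M"

definition serves :: "nat \<Rightarrow> (nat \<Rightarrow> 'a) \<Rightarrow> (nat \<Rightarrow> 'a) \<Rightarrow> bool" where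
  "serves k c r \<longleftrightarrow> (\<exists>i<k. c i = r i)"

definition move_cost ::
  "nat \<Rightarrow> (nat \<Rightarrow> 'a \<Rightarrow> 'a \<Rightarrow> real) \<Rightarrow> (nat \<Rightarrow> 'a) \<Rightarrow> (nat \<Rightarrow> 'a) \<Rightarrow> real" where
  "move_cost k d c c' = (\<Sum>i<k. d i (c i) (c' i))"

(* A schedule lists, for each request, the configuration in which that request is served;
   the initial configuration c0 is not part of the list. *)
definition feasible_schedule ::
  "nat \<Rightarrow> (nat \<Rightarrow> 'a set) \<Rightarrow> (nat \<Rightarrow> 'a) list \<Rightarrow> (nat \<Rightarrow> 'a) list \<Rightarrow> bool" where
  "feasible_schedule k M \<sigma> cs \<longleftrightarrow> cs \<in> lists (configs k M) \<and> list_all2 (serves k) cs \<sigma>"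

fun schedule_cost ::
  "nat \<Rightarrow> (nat \<Rightarrow> 'a \<Rightarrow> 'a \<Rightarrow> real) \<Rightarrow> (nat \<Rightarrow> 'a) \<Rightarrow> (nat \<Rightarrow> 'a) list \<Rightarrow> real" where
  "schedule_cost k d c0 [] = 0"
| "schedule_cost k d c0 (c # cs) = move_cost k d c0 c + schedule_cost k d c cs"

(* For k > 0 and requests in configs k M, feasible schedules exist and (for metrics d i) their
   costs are nonnegative, so this real infimum is well-behaved. *)
definition opt_cost ::
  "nat \<Rightarrow> (nat \<Rightarrow> 'a set) \<Rightarrow> (nat \<Rightarrow> 'a \<Rightarrow> 'a \<Rightarrow> real) \<Rightarrow> (nat \<Rightarrow> 'a) \<Rightarrow> (nat \<Rightarrow> 'a) list \<Rightarrow> real" where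
  "opt_cost k M d c0 \<sigma> = Inf {schedule_cost k d c0 cs |cs. feasible_schedule k M \<sigma> cs}"

(* A deterministic online algorithm maps the sequence of requests seen so far (including the
   current one) to the configuration it moves to. *)
type_synonym 'a online_alg = "(nat \<Rightarrow> 'a) list \<Rightarrow> (nat \<Rightarrow> 'a)"

definition run :: "'a online_alg \<Rightarrow> (nat \<Rightarrow> 'a) list \<Rightarrow> (nat \<Rightarrow> 'a) list" where
  "run A \<sigma> = map (\<lambda>t. A (take (Suc t) \<sigma>)) [0..<length \<sigma>]"

definition valid_online_alg :: "nat \<Rightarrow> (nat \<Rightarrow> 'a set) \<Rightarrow> 'a online_alg \<Rightarrow> bool" where
  "valid_online_alg k M A \<longleftrightarrow>
     (\<forall>\<sigma> \<in> lists (configs k M). feasible_schedule k M \<sigma> (run A \<sigma>))"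

definition competitive ::
  "nat \<Rightarrow> (nat \<Rightarrow> 'a set) \<Rightarrow> (nat \<Rightarrow> 'a \<Rightarrow> 'a \<Rightarrow> real) \<Rightarrow> (nat \<Rightarrow> 'a) \<Rightarrow> real \<Rightarrow> 'a online_alg \<Rightarrow> bool" where
  "competitive k M d c0 c A \<longleftrightarrow>
     (\<exists>a. \<forall>\<sigma> \<in> lists (configs k M).
        schedule_cost k d c0 (run A \<sigma>) \<le> c * opt_cost k M d c0 \<sigma> + a)"

end

(* Order the servers by weight and construct, by induction on n, an online algorithm for the n
   lightest servers against an adversary with a free starting configuration.  For n + 1 servers, fix
   the heaviest one (of weight W) at a point q and let the algorithm for n servers handle the requests
   not served at q, until the optimal offline cost of these requests exceeds a budget of order W; then
   move the heaviest server to a point p for which the requests of the current phase that are not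
   served at p can still be handled by the lighter servers at cost at most W.  When there is no such
   p, every offline strategy has paid W, and a new phase starts.

   A phase has at most 2^2^n segments: suppose that m such points p exist, each with a
   strategy of cost at most W that misses only requests with r n = p.  Every request is missed by at
   most one of the m strategies, and a hierarchical majority vote, from the heaviest coordinate
   down, combines them into one strategy that serves everything and costs at most n times their
   total; for m doubly exponential in n this would contradict the exhausted budget. *)
theory Submission
  imports Defs "HOL-Library.Sublist"
begin

section \<open>Costs of schedules under uniform distances\<close>

text \<open>Total on the whole type: the algorithms built below may use points outside the carriers,
  and only the final reduction projects back into them.\<close>

definition udist :: "(nat \<Rightarrow> real) \<Rightarrow> nat \<Rightarrow> 'a \<Rightarrow> 'a \<Rightarrow> real" where
  "udist w i x y = (if x = y then 0 else w i)"

(* The starting configuration is free. *)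
definition path_cost :: "nat \<Rightarrow> (nat \<Rightarrow> real) \<Rightarrow> (nat \<Rightarrow> 'a) list \<Rightarrow> real" where
  "path_cost n w cs = schedule_cost n (udist w) (hd cs) cs"

lemma move_cost_nonneg:
  assumes "\<And>i. i < n \<Longrightarrow> 0 \<le> w i"
  shows "0 \<le> move_cost n (udist w) c c'"
  using assms by (auto simp: move_cost_def udist_def intro!: sum_nonneg)

lemma move_cost_self [simp]: "move_cost n (udist w) c c = 0"
  by (simp add: move_cost_def udist_def)

lemma move_cost_triangle:
  assumes "\<And>i. i < n \<Longrightarrow> 0 \<le> w i"
  shows "move_cost n (udist w) a c \<le> move_cost n (udist w) a b + move_cost n (udist w) b c"
  unfolding move_cost_def sum.distrib[symmetric]
  using assms by (intro sum_mono) (auto simp: udist_def)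

lemma move_cost_le:
  assumes "\<And>i. i < n \<Longrightarrow> 0 \<le> w i" "\<And>i. i < n \<Longrightarrow> w i \<le> W"
  shows "move_cost n (udist w) c c' \<le> n * W"
proof -
  have "udist w i (c i) (c' i) \<le> W" if "i < n" for i
    using assms(1)[OF that] assms(2)[OF that] by (auto simp: udist_def)
  then have "move_cost n (udist w) c c' \<le> (\<Sum>i<n. W)"
    unfolding move_cost_def by (intro sum_mono) auto
  then show ?thesis by simp
qed

lemma schedule_cost_nonneg:
  assumes "\<And>i. i < n \<Longrightarrow> 0 \<le> w i"
  shows "0 \<le> schedule_cost n (udist w) c cs"
  by (induction cs arbitrary: c) (auto intro!: add_nonneg_nonneg move_cost_nonneg assms)

lemma path_cost_nonneg:
  assumes "\<And>i. i < n \<Longrightarrow> 0 \<le> w i"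
  shows "0 \<le> path_cost n w cs"
  unfolding path_cost_def by (rule schedule_cost_nonneg[OF assms])

lemma path_cost_Nil [simp]: "path_cost n w [] = 0"
  and path_cost_Cons [simp]: "path_cost n w (c # cs) = schedule_cost n (udist w) c cs"
  by (simp_all add: path_cost_def)

lemma schedule_cost_append:
  "schedule_cost n d c (xs @ ys) = schedule_cost n d c xs + schedule_cost n d (last (c # xs)) ys"
  by (induction xs arbitrary: c) auto

lemma schedule_cost_conv_sum:
  "schedule_cost n d c cs = (\<Sum>t<length cs. move_cost n d ((c # cs) ! t) (cs ! t))"
proof (induction cs arbitrary: c)
  case (Cons a cs)
  then show ?case by (simp add: sum.lessThan_Suc_shift del: sum.lessThan_Suc)
qed simp

lemma path_cost_append:
  "path_cost n w (xs @ c # ys) = path_cost n w (xs @ [c]) + path_cost n w (c # ys)"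
  by (cases xs) (simp_all add: schedule_cost_append)

text \<open>Skipping a configuration merges two moves into one, which is no dearer by the triangle
  inequality.\<close>

lemma schedule_cost_subseq:
  assumes "subseq xs ys" and w: "\<And>i. i < n \<Longrightarrow> 0 \<le> w i"
  shows "schedule_cost n (udist w) c xs \<le> schedule_cost n (udist w) c ys"
  using assms(1)
proof (induction arbitrary: c)
  case (list_emb_Nil ys)
  then show ?case by (simp add: schedule_cost_nonneg[OF w])
next
  case (list_emb_Cons xs ys y)
  have "schedule_cost n (udist w) c xs \<le> move_cost n (udist w) c y + schedule_cost n (udist w) y xs"
  proof (cases xs)
    case Nil
    then show ?thesis by (simp add: move_cost_nonneg[OF w])
  next
    case (Cons x xs')
    then show ?thesis using move_cost_triangle[where a=c and b=y and c=x, OF w] by simp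
  qed
  with list_emb_Cons.IH[of y] show ?case by simp
qed auto

lemma path_cost_subseq:
  assumes "subseq xs ys" and w: "\<And>i. i < n \<Longrightarrow> 0 \<le> w i"
  shows "path_cost n w xs \<le> path_cost n w ys"
proof (cases xs)
  case Nil
  then show ?thesis by (simp add: path_cost_nonneg[OF w])
next
  case (Cons x xs')
  \<comment> \<open>The free start absorbs everything before the first kept configuration
    \<open>x\<close>.\<close>
  with assms(1) obtain us vs where ys: "ys = us @ x # vs" "subseq xs' vs"
    using list_emb_ConsD[of "(=)" x xs' ys] by auto
  have "path_cost n w xs \<le> path_cost n w (x # vs)"
    using schedule_cost_subseq[OF ys(2) w] Cons by simp
  also have "\<dots> \<le> path_cost n w ys"
    unfolding ys(1) path_cost_append[of n w us x vs] using path_cost_nonneg[of n w "us @ [x]"] w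
    by simp
  finally show ?thesis .
qed

lemma serves_Suc: "serves (Suc n) c r \<longleftrightarrow> c n = r n \<or> serves n c r"
  by (auto simp: serves_def less_Suc_eq)

lemma serves_fun_upd [simp]: "serves n (c(n := a)) r \<longleftrightarrow> serves n c r"
  by (auto simp: serves_def)

lemma list_all2_snoc: "list_all2 P (xs @ [x]) (ys @ [y]) \<longleftrightarrow> list_all2 P xs ys \<and> P x y"
  by (subst list_all2_rev[symmetric]) auto

lemma run_snoc: "run A (\<sigma> @ [r]) = run A \<sigma> @ [A (\<sigma> @ [r])]"
  by (simp add: run_def)

lemma run_Nil [simp]: "run A [] = []"
  by (simp add: run_def)

lemma last_run: "last (A [] # run A \<sigma>) = A \<sigma>"
  by (cases \<sigma> rule: rev_cases) (simp_all add: run_snoc)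

lemma schedule_cost_run_snoc:
  "schedule_cost n d (A []) (run A (\<sigma> @ [r])) =
     schedule_cost n d (A []) (run A \<sigma>) + move_cost n d (A \<sigma>) (A (\<sigma> @ [r]))"
  using last_run[of A \<sigma>] by (simp add: run_snoc schedule_cost_append)


section \<open>Combining offline strategies\<close>

text \<open>Voting threshold: if at most \<open>e\<close> voters fail, more than
  \<open>amp n * e\<close> voters determine \<open>n\<close> good coordinates. The recursion solves
  \<open>amp (Suc n) * e = amp n * (e + amp n * e)\<close>, where \<open>e + amp n * e\<close>
  bounds the failures once the top coordinate is ignored.\<close>

fun amp :: "nat \<Rightarrow> nat" where
  "amp 0 = 1"
| "amp (Suc n) = amp n * (amp n + 1)"

lemma amp_less: "amp n < 2 ^ 2 ^ n"
proof (induction n)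
  case (Suc n)
  have "amp n * (amp n + 1) < 2 ^ 2 ^ n * 2 ^ 2 ^ n"
    using Suc by (intro mult_less_le_imp_less) auto
  then show ?case by (simp flip: power_add mult_2)
qed simp

(* Coordinate j of the selected configuration depends only on the coordinates from j on of the
   given ones, so a cheap move never triggers a move of a heavier server. *)
fun sel :: "nat \<Rightarrow> nat \<Rightarrow> 'b set \<Rightarrow> ('b \<Rightarrow> nat \<Rightarrow> 'a) \<Rightarrow> nat \<Rightarrow> 'a" where
  "sel 0 e I c = (\<lambda>_. undefined)"
| "sel (Suc n) e I c =
     (if \<exists>a. amp n * e < card {i\<in>I. c i n = a}
      then let a = SOME a. amp n * e < card {i\<in>I. c i n = a}
           in (sel n e {i\<in>I. c i n = a} c)(n := a)
      else sel n (e + amp n * e) I c)"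

text \<open>If some value \<open>a\<close> of the top coordinate is popular, its voters agree on it:
  either \<open>r n = a\<close>, or those of them who serve \<open>r\<close> do so with a lighter
  coordinate. If no value is popular, few voters have \<open>r n\<close> on top, so ignoring that
  coordinate adds at most \<open>amp n * e\<close> failures.\<close>

lemma sel_serves:
  assumes "finite I" "amp n * e < card I" "card {i\<in>I. \<not> serves n (c i) r} \<le> e"
  shows "serves n (sel n e I c) r"
  using assms
proof (induction n arbitrary: e I)
  case 0
  then show ?case by (simp add: serves_def)
next
  case (Suc n)
  show ?case
  proof (cases "\<exists>a. amp n * e < card {i\<in>I. c i n = a}")
    case True
    define a where "a = (SOME a. amp n * e < card {i\<in>I. c i n = a})"
    define J where "J = {i\<in>I. c i n = a}"
    have J: "amp n * e < card J"
      unfolding J_def a_def by (rule someI_ex[OF True])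
    have sel: "sel (Suc n) e I c = (sel n e J c)(n := a)"
      using True by (simp add: a_def J_def Let_def)
    show ?thesis
    proof (cases "r n = a")
      case True
      then show ?thesis by (simp add: sel serves_Suc del: sel.simps fun_upd_apply add: fun_upd_same)
    next
      case False
      have "{i\<in>J. \<not> serves n (c i) r} \<subseteq> {i\<in>I. \<not> serves (Suc n) (c i) r}"
        using False by (auto simp: J_def serves_Suc)
      from card_mono[OF _ this] have "card {i\<in>J. \<not> serves n (c i) r} \<le> e"
        using Suc.prems(1,3) by simp
      then have "serves n (sel n e J c) r"
        using Suc.IH[of J e] J Suc.prems(1) by (simp add: J_def)
      then show ?thesis by (simp add: sel serves_Suc del: sel.simps fun_upd_apply add: fun_upd_same)
    qed
  next
    case False
    have "{i\<in>I. \<not> serves n (c i) r} \<subseteq>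
        {i\<in>I. \<not> serves (Suc n) (c i) r} \<union> {i\<in>I. c i n = r n}"
      by (auto simp: serves_Suc)
    then have "card {i\<in>I. \<not> serves n (c i) r} \<le>
        card ({i\<in>I. \<not> serves (Suc n) (c i) r} \<union> {i\<in>I. c i n = r n})"
      using Suc.prems(1) by (intro card_mono) auto
    also have "\<dots> \<le> card {i\<in>I. \<not> serves (Suc n) (c i) r} + card {i\<in>I. c i n = r n}"
      by (rule card_Un_le)
    also have "\<dots> \<le> e + amp n * e"
      using Suc.prems(3) False by (intro add_mono) (auto simp: not_less)
    finally have "serves n (sel n (e + amp n * e) I c) r"
      using Suc.prems by (intro Suc.IH) (auto simp: algebra_simps)
    then show ?thesis using False by (simp add: serves_Suc)
  qed
qed

lemma sel_undefined: "n \<le> l \<Longrightarrow> sel n e I c l = undefined"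
  by (induction n arbitrary: e I) (auto simp: Let_def)

lemma sel_cong:
  assumes "\<And>i l. i \<in> I \<Longrightarrow> j \<le> l \<Longrightarrow> l < n \<Longrightarrow> c i l = c' i l" "j < n"
  shows "sel n e I c j = sel n e I c' j"
  using assms
proof (induction n arbitrary: e I)
  case (Suc n)
  have top: "{i\<in>I. c i n = a} = {i\<in>I. c' i n = a}" for a
    using Suc.prems by auto
  show ?case
  proof (cases "j = n")
    case True
    \<comment> \<open>If no value is popular, coordinate \<open>n\<close> is
      \<open>undefined\<close>, an ordinary point for \<open>udist\<close>.\<close>
    with True show ?thesis by (simp add: top Let_def sel_undefined)
  next
    case False
    then have "sel n e' I' c j = sel n e' I' c' j" if "I' \<subseteq> I" for e' I'
      using that Suc.prems by (intro Suc.IH) auto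
    from this[of "{i\<in>I. c' i n = a}" for a] this[of I] show ?thesis
      using False by (simp add: top Let_def)
  qed
qed simp

text \<open>If the selected coordinate \<open>j\<close> changes, some voter changes a coordinate
  \<open>l\<close> with \<open>j \<le> l\<close> and pays at least \<open>w j\<close>. So each of
  the \<open>n\<close> coordinates costs at most the sum over all voters.\<close>

lemma move_cost_sel:
  assumes "finite I" and w: "\<And>i. i < n \<Longrightarrow> 0 \<le> w i" "\<And>i j. i \<le> j \<Longrightarrow> j < n \<Longrightarrow> w i \<le> w j"
  shows "move_cost n (udist w) (sel n e I c) (sel n e I c') \<le>
    n * (\<Sum>i\<in>I. move_cost n (udist w) (c i) (c' i))"
proof -
  have "udist w j (sel n e I c j) (sel n e I c' j) \<le> (\<Sum>i\<in>I. move_cost n (udist w) (c i) (c' i))"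
    if "j < n" for j
  proof (cases "sel n e I c j = sel n e I c' j")
    case True
    then show ?thesis
      by (auto simp: udist_def intro!: sum_nonneg move_cost_nonneg w(1))
  next
    case False
    then obtain i l where il: "i \<in> I" "j \<le> l" "l < n" "c i l \<noteq> c' i l"
      using sel_cong[of I j n c c'] \<open>j < n\<close> by blast
    have "udist w j (sel n e I c j) (sel n e I c' j) = w j"
      using False by (simp add: udist_def)
    also have "\<dots> \<le> udist w l (c i l) (c' i l)"
      using il w(2) by (simp add: udist_def)
    also have "\<dots> \<le> move_cost n (udist w) (c i) (c' i)"
      unfolding move_cost_def using il w(1)
      by (intro member_le_sum) (auto simp: udist_def)
    also have "\<dots> \<le> (\<Sum>i\<in>I. move_cost n (udist w) (c i) (c' i))"
      using il assms(1) by (intro member_le_sum) (auto intro!: move_cost_nonneg w(1))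
    finally show ?thesis .
  qed
  then have "(\<Sum>j<n. udist w j (sel n e I c j) (sel n e I c' j)) \<le>
      (\<Sum>j<n. \<Sum>i\<in>I. move_cost n (udist w) (c i) (c' i))"
    by (intro sum_mono) auto
  then show ?thesis by (simp add: move_cost_def[of n "udist w" "sel n e I c"])
qed

(* Requests with r n = q are served by server n, which rests at q at no cost. *)
definition cheap :: "nat \<Rightarrow> (nat \<Rightarrow> real) \<Rightarrow> real \<Rightarrow> 'a \<Rightarrow> (nat \<Rightarrow> 'a) list \<Rightarrow> bool" where
  "cheap n w y q \<tau> \<longleftrightarrow>
     (\<exists>cs. list_all2 (\<lambda>c r. r n = q \<or> serves n c r) cs \<tau> \<and> path_cost n w cs \<le> y)"

lemma cheap_mono: "cheap n w x q \<tau> \<Longrightarrow> x \<le> y \<Longrightarrow> cheap n w y q \<tau>"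
  by (force simp: cheap_def)

lemma cheap_appendD:
  assumes "cheap n w y q (\<rho> @ \<tau>)" and w: "\<And>i. i < n \<Longrightarrow> 0 \<le> w i"
  shows "cheap n w y q \<rho>" "cheap n w y q \<tau>"
proof -
  obtain cs where cs: "list_all2 (\<lambda>c r. r n = q \<or> serves n c r) cs (\<rho> @ \<tau>)" "path_cost n w cs \<le> y"
    using assms(1) by (auto simp: cheap_def)
  then obtain us vs where uv: "cs = us @ vs" "list_all2 (\<lambda>c r. r n = q \<or> serves n c r) us \<rho>"
      "list_all2 (\<lambda>c r. r n = q \<or> serves n c r) vs \<tau>"
    by (auto simp: list_all2_append2)
  have "path_cost n w us \<le> path_cost n w cs" "path_cost n w vs \<le> path_cost n w cs"
    using uv(1) by (auto intro!: path_cost_subseq w)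
  with cs uv show "cheap n w y q \<rho>" "cheap n w y q \<tau>"
    unfolding cheap_def by force+
qed

lemma cheap_singleton: "0 \<le> y \<Longrightarrow> cheap n w y (r n) [r]"
  by (auto simp: cheap_def intro!: exI[of _ "[undefined]"])

text \<open>Configurations at requests with \<open>r n = q\<close> are unconstrained and can be
  skipped. The rest is an offline strategy of the lighter servers, against which their online
  algorithm is measured.\<close>

lemma cheap_filter:
  assumes "cheap n w y q \<tau>" and w: "\<And>i. i < n \<Longrightarrow> 0 \<le> w i"
  shows "\<exists>cs. list_all2 (serves n) cs (filter (\<lambda>r. r n \<noteq> q) \<tau>) \<and> path_cost n w cs \<le> y"
proof -
  obtain cs where cs: "list_all2 (\<lambda>c r. r n = q \<or> serves n c r) cs \<tau>" "path_cost n w cs \<le> y"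
    using assms(1) by (auto simp: cheap_def)
  from cs(1) have "\<exists>us. subseq us cs \<and> list_all2 (serves n) us (filter (\<lambda>r. r n \<noteq> q) \<tau>)"
  proof (induction rule: list_all2_induct)
    case (Cons c cs r \<tau>)
    then obtain us where us: "subseq us cs" "list_all2 (serves n) us (filter (\<lambda>r. r n \<noteq> q) \<tau>)"
      by blast
    show ?case
    proof (cases "r n = q")
      case True
      with us show ?thesis by (auto intro!: exI[of _ us])
    next
      case False
      with us Cons.hyps show ?thesis by (auto intro!: exI[of _ "c # us"])
    qed
  qed auto
  then obtain us where "subseq us cs" "list_all2 (serves n) us (filter (\<lambda>r. r n \<noteq> q) \<tau>)"
    by blast
  moreover from this(1) have "path_cost n w us \<le> path_cost n w cs"
    by (rule path_cost_subseq) (rule w)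
  ultimately show ?thesis using cs(2) by force
qed

lemma path_cost_map_upt:
  "path_cost n w (map g [0..<L]) = (\<Sum>t<L - 1. move_cost n (udist w) (g t) (g (Suc t)))"
proof (cases L)
  case (Suc l)
  have "map g [0..<L] = g 0 # map (\<lambda>t. g (Suc t)) [0..<l]"
    unfolding Suc upt_conv_Cons[OF zero_less_Suc] map_Suc_upt[symmetric] by simp
  moreover have "(g 0 # map (\<lambda>t. g (Suc t)) [0..<l]) ! t = g t" if "t < l" for t
    using that by (cases t) auto
  ultimately show ?thesis using Suc by (simp add: schedule_cost_conv_sum)
qed simp

text \<open>The point \<open>q\<close> is arbitrary because the combined strategy serves every
  request with the lighter servers alone.\<close>

lemma cheap_combine:
  fixes W :: real
  assumes "finite I" "card I = amp n + 1" "\<And>p. p \<in> I \<Longrightarrow> cheap n w W p \<tau>"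
    and w: "\<And>i. i < n \<Longrightarrow> 0 \<le> w i" "\<And>i j. i \<le> j \<Longrightarrow> j < n \<Longrightarrow> w i \<le> w j"
  shows "cheap n w (n * (amp n + 1) * W) q \<tau>"
proof -
  define L where "L = length \<tau>"
  have "\<forall>p\<in>I. \<exists>cs. list_all2 (\<lambda>c r. r n = p \<or> serves n c r) cs \<tau> \<and> path_cost n w cs \<le> W"
    using assms(3) by (simp add: cheap_def)
  then obtain S where S: "\<And>p. p \<in> I \<Longrightarrow> list_all2 (\<lambda>c r. r n = p \<or> serves n c r) (S p) \<tau>"
      "\<And>p. p \<in> I \<Longrightarrow> path_cost n w (S p) \<le> W"
    by metis
  define g where "g = (\<lambda>t. sel n 1 I (\<lambda>p. S p ! t))"
  have len: "length (S p) = L" if "p \<in> I" for p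
    using S(1)[OF that] by (simp add: L_def list_all2_lengthD)
  have Scost: "path_cost n w (S p) = (\<Sum>t<L - 1. move_cost n (udist w) (S p ! t) (S p ! Suc t))"
    if "p \<in> I" for p
    using path_cost_map_upt[of n w "\<lambda>t. S p ! t" L] len[OF that] map_nth[of "S p"] by simp
  have "serves n (g t) (\<tau> ! t)" if "t < L" for t
    unfolding g_def
  proof (rule sel_serves)
    \<comment> \<open>Only the strategy belonging to the point \<open>(\<tau> ! t) n\<close> can
      miss this request, hence \<open>e = 1\<close> and \<open>amp n + 1\<close> voters.\<close>
    have sub: "{p\<in>I. \<not> serves n (S p ! t) (\<tau> ! t)} \<subseteq> {(\<tau> ! t) n}"
      using S(1) that len by (auto simp: list_all2_conv_all_nth)
    show "card {p\<in>I. \<not> serves n (S p ! t) (\<tau> ! t)} \<le> 1"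
      using card_mono[OF _ sub] by simp
  qed (use assms in auto)
  then have "list_all2 (\<lambda>c r. r n = q \<or> serves n c r) (map g [0..<L]) \<tau>"
    by (simp add: list_all2_conv_all_nth L_def)
  moreover have "path_cost n w (map g [0..<L]) \<le> n * (amp n + 1) * W"
  proof -
    have "path_cost n w (map g [0..<L]) \<le>
        (\<Sum>t<L - 1. n * (\<Sum>p\<in>I. move_cost n (udist w) (S p ! t) (S p ! Suc t)))"
      unfolding path_cost_map_upt g_def by (intro sum_mono move_cost_sel assms(1) w)
    also have "\<dots> = n * (\<Sum>p\<in>I. \<Sum>t<L - 1. move_cost n (udist w) (S p ! t) (S p ! Suc t))"
      by (subst sum.swap) (simp add: sum_distrib_left)
    also have "\<dots> \<le> n * (\<Sum>p\<in>I. W)"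
      using S(2) Scost by (intro mult_left_mono sum_mono) auto
    finally show ?thesis by (simp add: assms(2) algebra_simps)
  qed
  ultimately show ?thesis unfolding cheap_def by blast
qed

lemma finite_cheap_points:
  fixes W :: real
  assumes "\<not> cheap n w (n * (amp n + 1) * W) q \<tau>"
    and "\<And>i. i < n \<Longrightarrow> 0 \<le> w i" "\<And>i j. i \<le> j \<Longrightarrow> j < n \<Longrightarrow> w i \<le> w j"
  shows "finite {p. cheap n w W p \<tau>}" "card {p. cheap n w W p \<tau>} \<le> amp n"
proof -
  have no: "\<not> (finite I \<and> card I = amp n + 1 \<and> I \<subseteq> {p. cheap n w W p \<tau>})" for I
    using cheap_combine[of I n w W \<tau> q] assms by blast
  then show fin: "finite {p. cheap n w W p \<tau>}"
    using infinite_arbitrarily_large by blast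
  show "card {p. cheap n w W p \<tau>} \<le> amp n"
  proof (rule ccontr)
    assume "\<not> ?thesis"
    then have "amp n + 1 \<le> card {p. cheap n w W p \<tau>}" by simp
    then show False using obtain_subset_with_card_n no by metis
  qed
qed

text \<open>A path of cost below \<open>w n\<close> never moves server \<open>n\<close>. This server
  then rests at one point \<open>q\<close>, and the moves of the lighter servers witness that
  \<open>\<tau>\<close> is cheap at \<open>q\<close>.\<close>

lemma path_cost_or_cheap:
  assumes "list_all2 (serves (Suc n)) cs \<tau>" and w: "\<And>i. i \<le> n \<Longrightarrow> 0 \<le> w i"
    and "\<And>p. \<not> cheap n w (w n) p \<tau>"
  shows "w n \<le> path_cost (Suc n) w cs"
proof (rule ccontr)
  assume less: "\<not> ?thesis"
  have split: "schedule_cost (Suc n) (udist w) c cs = schedule_cost n (udist w) c cs +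
      (\<Sum>t<length cs. udist w n (((c # cs) ! t) n) ((cs ! t) n))" for c and cs :: "(nat \<Rightarrow> 'a) list"
    by (simp add: schedule_cost_conv_sum move_cost_def sum.distrib)
  have const: "\<forall>c'\<in>set cs. c' n = c n"
    if "schedule_cost (Suc n) (udist w) c cs < w n" for c and cs :: "(nat \<Rightarrow> 'a) list"
    using that
  proof (induction cs arbitrary: c)
    case (Cons a cs)
    have "0 \<le> move_cost n (udist w) c a" "0 \<le> schedule_cost (Suc n) (udist w) a cs"
      by (auto intro!: move_cost_nonneg schedule_cost_nonneg w)
    moreover have "move_cost (Suc n) (udist w) c a = move_cost n (udist w) c a + udist w n (c n) (a n)"
      by (simp add: move_cost_def)
    ultimately have "a n = c n" and "schedule_cost (Suc n) (udist w) a cs < w n"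
      using Cons.prems w[of n] udist_def[of w n "c n" "a n"] by (auto split: if_splits)
    with Cons.IH[of a] show ?case by simp
  qed simp
  define q where "q = hd cs n"
  have q: "c n = q" if "c \<in> set cs" for c
    using const[of "hd cs" cs] less that by (simp add: path_cost_def q_def)
  have "list_all2 (\<lambda>c r. r n = q \<or> serves n c r) cs \<tau>"
    unfolding list_all2_conv_all_nth
  proof (intro conjI allI impI)
    show "length cs = length \<tau>"
      using assms(1) by (rule list_all2_lengthD)
    fix t assume "t < length cs"
    then have "serves (Suc n) (cs ! t) (\<tau> ! t)" "(cs ! t) n = q"
      using assms(1) q by (auto simp: list_all2_conv_all_nth)
    then show "(\<tau> ! t) n = q \<or> serves n (cs ! t) (\<tau> ! t)"
      by (auto simp: serves_Suc)
  qed
  moreover have "path_cost n w cs \<le> path_cost (Suc n) w cs"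
    unfolding path_cost_def split using w by (auto intro!: sum_nonneg simp: udist_def)
  ultimately show False
    using assms(3) less unfolding cheap_def by force
qed


section \<open>The online algorithm\<close>

text \<open>Comparing with every offline strategy \<open>cs\<close> avoids an infimum and makes
  \<open>n = 0\<close>, where only the empty sequence can be served, a usable base case. The
  algorithm starts at \<open>f []\<close>, a configuration of its own choice.\<close>

definition solves :: "nat \<Rightarrow> (nat \<Rightarrow> real) \<Rightarrow> real \<Rightarrow> real \<Rightarrow> 'a online_alg \<Rightarrow> bool" where
  "solves n w W G f \<longleftrightarrow>
     (\<forall>\<tau> cs. list_all2 (serves n) cs \<tau> \<longrightarrow>
        (\<tau> \<noteq> [] \<longrightarrow> serves n (f \<tau>) (last \<tau>)) \<and>
        schedule_cost n (udist w) (f []) (run f \<tau>) \<le> G * (path_cost n w cs + W))"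

record 'a state =
  phases :: nat
  hist :: "(nat \<Rightarrow> 'a) list"
  used :: "'a set"
  seg :: "(nat \<Rightarrow> 'a) list"
  pos :: 'a

(* A phase (with requests hist) is divided into segments; seg is the current one.  During a segment
   server n rests at pos, and the set used collects its positions in the previous segments of the
   phase.  The field phases counts the completed phases. *)
locale layer =
  fixes n :: nat and w :: "nat \<Rightarrow> real" and G :: real and f :: "'a online_alg"
  assumes w_mono: "i \<le> j \<Longrightarrow> j \<le> n \<Longrightarrow> w i \<le> w j"
    and w_pos: "i \<le> n \<Longrightarrow> 0 < w i"
    and G_nonneg: "0 \<le> G"
    and f: "solves n w (w n) G f"
begin

text \<open>The cost bound of \<open>cheap_combine\<close>, with \<open>n + 1\<close> in place of
  \<open>n\<close> so that \<open>w n \<le> budget\<close> holds for \<open>n = 0\<close> too and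
  every new segment starts within budget.\<close>

definition budget :: real where
  "budget = (n + 1) * (amp n + 1) * w n"

text \<open>A new position must be cheap for the whole phase and not just for \<open>r\<close>,
  which excludes the positions already abandoned. A new phase starts at \<open>r n\<close>, where
  \<open>r\<close> costs the lighter servers nothing.\<close>

definition step :: "'a state \<Rightarrow> (nat \<Rightarrow> 'a) \<Rightarrow> 'a state" where
  "step s r =
     (if cheap n w budget (pos s) (seg s @ [r])
      then s\<lparr>hist := hist s @ [r], seg := seg s @ [r]\<rparr>
      else if \<exists>p. cheap n w (w n) p (hist s @ [r])
      then \<lparr>phases = phases s, hist = hist s @ [r], used = insert (pos s) (used s), seg = [r],
             pos = SOME p. cheap n w (w n) p (hist s @ [r])\<rparr>
      else \<lparr>phases = Suc (phases s), hist = [r], used = {}, seg = [r], pos = r n\<rparr>)"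

definition state :: "(nat \<Rightarrow> 'a) list \<Rightarrow> 'a state" where
  "state \<tau> = foldl step \<lparr>phases = 0, hist = [], used = {}, seg = [], pos = undefined\<rparr> \<tau>"

text \<open>Since \<open>seg\<close> shrinks to \<open>[r]\<close> at a switch or reset,
  \<open>f\<close> is restarted with every segment.\<close>

definition alg :: "'a online_alg" where
  "alg \<tau> = (f (filter (\<lambda>r. r n \<noteq> pos (state \<tau>)) (seg (state \<tau>))))(n := pos (state \<tau>))"

section \<open>Invariants of the state\<close>

lemma state_Nil [simp]:
  "state [] = \<lparr>phases = 0, hist = [], used = {}, seg = [], pos = undefined\<rparr>"
  by (simp add: state_def)

lemma state_snoc: "state (\<tau> @ [r]) = step (state \<tau>) r"
  by (simp add: state_def)

lemma w_nonneg: "i \<le> n \<Longrightarrow> 0 \<le> w i"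
  using w_pos by (simp add: less_imp_le)

lemma w_nonneg': "i < n \<Longrightarrow> 0 \<le> w i"
  using w_nonneg by simp

lemma budget_ge: "w n \<le> budget" "n * (amp n + 1) * w n \<le> budget"
proof -
  have "1 * w n \<le> real ((n + 1) * (amp n + 1)) * w n"
    by (rule mult_right_mono) (use w_nonneg in auto)
  then show "w n \<le> budget" by (simp add: budget_def)
  show "n * (amp n + 1) * w n \<le> budget"
    unfolding budget_def by (intro mult_right_mono) (use w_nonneg in auto)
qed

lemma cheap_suffix: "cheap n w y q \<tau> \<Longrightarrow> suffix \<rho> \<tau> \<Longrightarrow> cheap n w y q \<rho>"
  using cheap_appendD(2)[OF _ w_nonneg'] by (auto simp: suffix_def)

lemma cheap_butlast:
  assumes "cheap n w y q (\<tau> @ [r])"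
  shows "cheap n w y q \<tau>"
  using assms w_nonneg' by (rule cheap_appendD(1))

lemma state_cases:
  obtains (same) "cheap n w budget (pos (state \<tau>)) (seg (state \<tau>) @ [r])"
      "state (\<tau> @ [r]) = (state \<tau>)\<lparr>hist := hist (state \<tau>) @ [r], seg := seg (state \<tau>) @ [r]\<rparr>"
  | (switch) q where "\<not> cheap n w budget (pos (state \<tau>)) (seg (state \<tau>) @ [r])"
      "cheap n w (w n) q (hist (state \<tau>) @ [r])"
      "state (\<tau> @ [r]) = \<lparr>phases = phases (state \<tau>), hist = hist (state \<tau>) @ [r],
         used = insert (pos (state \<tau>)) (used (state \<tau>)), seg = [r], pos = q\<rparr>"
  | (reset) "\<And>p. \<not> cheap n w (w n) p (hist (state \<tau>) @ [r])"
      "state (\<tau> @ [r]) =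
         \<lparr>phases = Suc (phases (state \<tau>)), hist = [r], used = {}, seg = [r], pos = r n\<rparr>"
proof -
  let ?P = "\<lambda>p. cheap n w (w n) p (hist (state \<tau>) @ [r])"
  have "?P (SOME p. ?P p)" if "\<exists>p. ?P p"
    by (rule someI_ex[OF that])
  then show thesis
    using that
    by (cases "cheap n w budget (pos (state \<tau>)) (seg (state \<tau>) @ [r])"; cases "\<exists>p. ?P p")
      (auto simp: state_snoc step_def)
qed

lemma seg_suffix_hist: "suffix (seg (state \<tau>)) (hist (state \<tau>))"
proof (induction \<tau> rule: rev_induct)
  case (snoc r \<tau>)
  then show ?case by (cases rule: state_cases[of \<tau> r]) auto
qed simp

lemma hist_suffix: "suffix (hist (state \<tau>)) \<tau>"
proof (induction \<tau> rule: rev_induct)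
  case (snoc r \<tau>)
  then show ?case by (cases rule: state_cases[of \<tau> r]) auto
qed simp

lemma seg_snoc: "\<exists>us. seg (state (\<tau> @ [r])) = us @ [r]"
  by (cases rule: state_cases[of \<tau> r]) auto

lemma hist_snoc: "\<exists>us. hist (state (\<tau> @ [r])) = us @ [r]"
  by (cases rule: state_cases[of \<tau> r]) auto

lemma hist_eq_Nil_iff: "hist (state \<tau>) = [] \<longleftrightarrow> \<tau> = []"
  by (metis hist_snoc hist_suffix rev_exhaust snoc_eq_iff_butlast suffix_bot.extremum_uniqueI)

lemma cheap_seg: "cheap n w budget (pos (state \<tau>)) (seg (state \<tau>))"
proof (cases \<tau> rule: rev_cases)
  case Nil
  then show ?thesis using budget_ge(1) w_nonneg[of n] by (simp add: cheap_def)
next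
  case (snoc \<rho> r)
  show ?thesis
  proof (cases rule: state_cases[of \<rho> r])
    case same
    then show ?thesis using snoc by simp
  next
    case (switch q)
    then have "cheap n w budget q [r]"
      using cheap_mono[OF cheap_suffix budget_ge(1)] by (metis suffixI)
    then show ?thesis using switch snoc by simp
  next
    case reset
    then show ?thesis
      using cheap_singleton[of budget n w r] budget_ge(1) w_nonneg[of n] snoc by simp
  qed
qed

lemma not_cheap_hist:
  assumes "\<not> cheap n w budget p (seg (state \<tau>) @ [r])" "y \<le> budget"
  shows "\<not> cheap n w y p (hist (state \<tau>) @ [r])"
proof
  assume *: "cheap n w y p (hist (state \<tau>) @ [r])"
  have "suffix (seg (state \<tau>) @ [r]) (hist (state \<tau>) @ [r])"
    using seg_suffix_hist[of \<tau>] by simp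
  from cheap_mono[OF cheap_suffix[OF * this] assms(2)]
  have "cheap n w budget p (seg (state \<tau>) @ [r])" .
  with assms(1) show False ..
qed

text \<open>A position is abandoned when its segment exceeds the budget, which is at least
  \<open>w n\<close>. The history contains that segment and only grows until the phase ends.\<close>

lemma used_not_cheap: "p \<in> used (state \<tau>) \<Longrightarrow> \<not> cheap n w (w n) p (hist (state \<tau>))"
proof (induction \<tau> rule: rev_induct)
  case (snoc r \<tau>)
  show ?case
  proof (cases rule: state_cases[of \<tau> r])
    case same
    then show ?thesis using snoc by (auto dest: cheap_butlast)
  next
    case (switch q)
    then show ?thesis
      using snoc not_cheap_hist[OF switch(1) budget_ge(1)] by (auto dest: cheap_butlast)
  next
    case reset
    then show ?thesis using snoc by simp
  qed
qed simp

lemma pos_not_used: "pos (state \<tau>) \<notin> used (state \<tau>)"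
proof (induction \<tau> rule: rev_induct)
  case (snoc r \<tau>)
  show ?case
  proof (cases rule: state_cases[of \<tau> r])
    case same
    then show ?thesis using snoc by simp
  next
    case (switch q)
    \<comment> \<open>The new position is cheap for the extended history, whereas no used point is,
      not even the one just left.\<close>
    then show ?thesis using used_not_cheap[of q "\<tau> @ [r]"] by auto
  next
    case reset
    then show ?thesis by simp
  qed
qed simp

(* Once the first segment of a phase is over, no strategy serves the whole phase within the budget,
   so only few positions remain for the segments that follow. *)
lemma used_bound:
  "used (state \<tau>) = {} \<or>
   (\<exists>K q. finite K \<and> card K \<le> amp n \<and> pos (state \<tau>) \<in> K \<and> used (state \<tau>) \<subseteq> insert q K \<and>
      (\<forall>p. cheap n w (w n) p (hist (state \<tau>)) \<longrightarrow> p \<in> K))"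
proof (induction \<tau> rule: rev_induct)
  case (snoc r \<tau>)
  let ?s = "state \<tau>" and ?s' = "state (\<tau> @ [r])"
  show ?case
  proof (cases rule: state_cases[of \<tau> r])
    case same
    then have "hist ?s' = hist ?s @ [r]" "used ?s' = used ?s" "pos ?s' = pos ?s"
      by simp_all
    with snoc.IH cheap_butlast show ?thesis by metis
  next
    case (switch p)
    then have s': "hist ?s' = hist ?s @ [r]" "used ?s' = insert (pos ?s) (used ?s)"
        "cheap n w (w n) (pos ?s') (hist ?s')"
      by simp_all
    show ?thesis
    proof (cases "used ?s = {}")
      case True
      \<comment> \<open>At the first switch of a phase, \<open>K\<close> is taken as the set of
        points that are cheap now. The initial position becomes the exceptional point
        \<open>q\<close>.\<close>
      have "\<not> cheap n w (n * (amp n + 1) * w n) (pos ?s) (hist ?s')"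
        unfolding s'(1) by (rule not_cheap_hist[OF switch(1) budget_ge(2)])
      from finite_cheap_points[OF this w_nonneg' w_mono]
      have "finite {p. cheap n w (w n) p (hist ?s')}" "card {p. cheap n w (w n) p (hist ?s')} \<le> amp n"
        by auto
      with s' True show ?thesis by blast
    next
      case False
      then obtain K q where K: "finite K" "card K \<le> amp n" "pos ?s \<in> K" "used ?s \<subseteq> insert q K"
          "\<And>p. cheap n w (w n) p (hist ?s) \<Longrightarrow> p \<in> K"
        using snoc.IH by blast
      \<comment> \<open>The same \<open>K\<close> persists: a longer history has fewer cheap
        points.\<close>
      have K': "p \<in> K" if "cheap n w (w n) p (hist ?s')" for p
        using K(5) cheap_butlast that s'(1) by metis
      have "used ?s' \<subseteq> insert q K"
        using K(3,4) s'(2) by auto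
      with K(1,2) K' s'(3) show ?thesis by metis
    qed
  next
    case reset
    then show ?thesis by simp
  qed
qed simp

lemma finite_used: "finite (used (state \<tau>))"
  using used_bound[of \<tau>] by (elim disjE exE conjE) (auto intro: finite_subset)

lemma card_used: "card (used (state \<tau>)) \<le> amp n"
proof (cases "used (state \<tau>) = {}")
  case False
  then obtain K q where K: "finite K" "card K \<le> amp n" "pos (state \<tau>) \<in> K"
      "used (state \<tau>) \<subseteq> insert q K"
    using used_bound[of \<tau>] by blast
  have "insert (pos (state \<tau>)) (used (state \<tau>)) \<subseteq> insert q K"
    using K by auto
  then have "card (insert (pos (state \<tau>)) (used (state \<tau>))) \<le> card (insert q K)"
    using K(1) by (intro card_mono) auto
  also have "\<dots> \<le> Suc (amp n)"
    using card_insert_le_m1 K(1,2) by (simp add: card_insert_if)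
  finally show ?thesis
    using pos_not_used finite_used by simp
qed simp

section \<open>Online and offline cost of the phases\<close>

text \<open>One jump of all \<open>n + 1\<close> servers, each of weight at most \<open>w n\<close>,
  plus the cost of \<open>f\<close> on a segment within budget.\<close>

definition charge :: real where
  "charge = (n + 1) * w n + G * (budget + w n)"

lemma f_cost_nonneg: "0 \<le> schedule_cost n (udist w) c cs"
  by (rule schedule_cost_nonneg[OF w_nonneg'])

lemma f_cost_cheap:
  assumes "cheap n w budget q \<tau>"
  shows "schedule_cost n (udist w) (f []) (run f (filter (\<lambda>r. r n \<noteq> q) \<tau>)) \<le> G * (budget + w n)"
proof -
  obtain cs where cs: "list_all2 (serves n) cs (filter (\<lambda>r. r n \<noteq> q) \<tau>)" "path_cost n w cs \<le> budget"
    using cheap_filter[OF assms w_nonneg'] by blast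
  have "schedule_cost n (udist w) (f []) (run f (filter (\<lambda>r. r n \<noteq> q) \<tau>)) \<le> G * (path_cost n w cs + w n)"
    using f cs(1) by (simp add: solves_def)
  also have "\<dots> \<le> G * (budget + w n)"
    using cs(2) G_nonneg by (intro mult_left_mono) auto
  finally show ?thesis .
qed

lemma alg_serves:
  assumes "\<tau> \<noteq> []"
  shows "serves (Suc n) (alg \<tau>) (last \<tau>)"
proof (cases "last \<tau> n = pos (state \<tau>)")
  case True
  then show ?thesis by (simp add: alg_def serves_Suc)
next
  case False
  obtain \<rho> r where \<tau>: "\<tau> = \<rho> @ [r]" using assms by (metis rev_exhaust)
  obtain us where us: "seg (state \<tau>) = us @ [r]" using seg_snoc \<tau> by blast
  obtain cs where "list_all2 (serves n) cs (filter (\<lambda>r. r n \<noteq> pos (state \<tau>)) (seg (state \<tau>)))"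
    using cheap_filter[OF cheap_seg w_nonneg'] by blast
  then have "serves n (f (filter (\<lambda>r. r n \<noteq> pos (state \<tau>)) (seg (state \<tau>)))) r"
    using f us False \<tau> unfolding solves_def by fastforce
  then show ?thesis using \<tau> by (simp add: alg_def serves_Suc del: fun_upd_apply add: fun_upd_same)
qed

text \<open>Each finished segment is paid by one \<open>charge\<close>, at most
  \<open>amp n + 1\<close> of them per finished phase; the current segment is counted at its actual
  cost under \<open>f\<close>.\<close>

lemma alg_cost:
  "schedule_cost (Suc n) (udist w) (alg []) (run alg \<tau>) \<le>
     (phases (state \<tau>) * (amp n + 1) + card (used (state \<tau>))) * charge +
     schedule_cost n (udist w) (f []) (run f (filter (\<lambda>r. r n \<noteq> pos (state \<tau>)) (seg (state \<tau>))))"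
proof (induction \<tau> rule: rev_induct)
  case Nil
  show ?case by simp
next
  case (snoc r \<tau>)
  let ?s = "state \<tau>" and ?s' = "state (\<tau> @ [r])"
  let ?c = "\<lambda>s. schedule_cost n (udist w) (f []) (run f (filter (\<lambda>r. r n \<noteq> pos s) (seg s)))"
  have charge_nonneg: "0 \<le> charge"
    using w_nonneg[of n] G_nonneg budget_ge(1) by (simp add: charge_def)
  have "move_cost (Suc n) (udist w) (alg \<tau>) (alg (\<tau> @ [r])) \<le> Suc n * w n"
    by (rule move_cost_le) (auto intro: w_nonneg w_mono)
  moreover have "?c ?s \<le> G * (budget + w n)"
    by (rule f_cost_cheap[OF cheap_seg])
  ultimately have jump: "?c ?s + move_cost (Suc n) (udist w) (alg \<tau>) (alg (\<tau> @ [r])) \<le> charge + ?c ?s'"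
    using f_cost_nonneg[of "f []" "run f (filter (\<lambda>r. r n \<noteq> pos ?s') (seg ?s'))"]
    by (simp add: charge_def)
  \<comment> \<open>Here \<open>x\<close> is the number of segments that \<open>r\<close>
    ends.\<close>
  have goal: ?case if
    "?c ?s + move_cost (Suc n) (udist w) (alg \<tau>) (alg (\<tau> @ [r])) \<le> x * charge + ?c ?s'"
    "phases ?s * (amp n + 1) + card (used ?s) + x \<le> phases ?s' * (amp n + 1) + card (used ?s')" for x :: nat
  proof -
    have "real (phases ?s * (amp n + 1) + card (used ?s) + x) * charge \<le>
        real (phases ?s' * (amp n + 1) + card (used ?s')) * charge"
      using that(2) charge_nonneg by (intro mult_right_mono) linarith+
    with that(1) snoc.IH show ?thesis
      unfolding schedule_cost_run_snoc by (simp add: algebra_simps)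
  qed
  show ?case
  proof (cases rule: state_cases[of \<tau> r])
    case same
    note s' = same(2)
    \<comment> \<open>Server \<open>n\<close> rests, so the move is one step of \<open>f\<close>, or
      none when \<open>r\<close> is filtered out.\<close>
    have "move_cost (Suc n) (udist w) (alg \<tau>) (alg (\<tau> @ [r])) =
        move_cost n (udist w) (f (filter (\<lambda>r. r n \<noteq> pos ?s) (seg ?s)))
          (f (filter (\<lambda>r. r n \<noteq> pos ?s) (seg ?s @ [r])))"
      unfolding alg_def s' by (simp add: move_cost_def udist_def)
    then have "?c ?s + move_cost (Suc n) (udist w) (alg \<tau>) (alg (\<tau> @ [r])) = ?c ?s'"
      unfolding s' by (simp add: schedule_cost_run_snoc)
    then show ?thesis using goal[of 0] s' by simp
  next
    case (switch q)
    then have "phases ?s' = phases ?s" "used ?s' = insert (pos ?s) (used ?s)"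
      by simp_all
    then show ?thesis using goal[of 1] jump pos_not_used[of \<tau>] finite_used[of \<tau>] by simp
  next
    case reset
    then have "phases ?s' = Suc (phases ?s)" "used ?s' = {}"
      by simp_all
    \<comment> \<open>The finished phase has at most \<open>amp n\<close> earlier segments and the
      one ending now.\<close>
    then show ?thesis using goal[of 1] jump card_used[of \<tau>] by simp
  qed
qed

(* A phase is charged to the moves up to and including the one that serves the first request of
   the next phase. *)
lemma offline_cost:
  assumes "list_all2 (serves (Suc n)) (us @ c # vs) \<tau>" "length (hist (state \<tau>)) = Suc (length vs)"
  shows "phases (state \<tau>) * w n \<le> path_cost (Suc n) w (us @ [c])"
  using assms
proof (induction \<tau> arbitrary: us c vs rule: rev_induct)
  case (snoc r \<tau>)
  let ?s = "state \<tau>" and ?s' = "state (\<tau> @ [r])"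
  have nonneg: "0 \<le> w i" if "i < Suc n" for i
    using that w_nonneg by simp
  show ?case
  proof (cases "\<tau> = []")
    case True
    \<comment> \<open>The first request cannot end a phase, since \<open>[r]\<close> is cheap at
      \<open>r n\<close>.\<close>
    have "phases ?s' = 0"
      using cheap_singleton[OF w_nonneg, of n n w r] True
      by (cases rule: state_cases[of \<tau> r]) auto
    then show ?thesis using path_cost_nonneg[OF nonneg] by simp
  next
    case False
    show ?thesis
    proof (cases "hist ?s' = hist ?s @ [r] \<and> phases ?s' = phases ?s")
      case True
      with snoc.prems(2) False have "vs \<noteq> []"
        using hist_eq_Nil_iff[of \<tau>] by auto
      then obtain vs' c' where vs: "vs = vs' @ [c']"
        by (metis rev_exhaust)
      with snoc.prems True have "list_all2 (serves (Suc n)) ((us @ c # vs') @ [c']) (\<tau> @ [r])"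
          "length (hist ?s) = Suc (length vs')"
        by auto
      with snoc.IH[of us c vs'] True show ?thesis
        unfolding list_all2_snoc by simp
    next
      case reset: False
      then have s': "phases ?s' = Suc (phases ?s)" "hist ?s' = [r]"
          and not_cheap: "\<And>p. \<not> cheap n w (w n) p (hist ?s @ [r])"
        by (cases rule: state_cases[of \<tau> r]; simp)+
      then have "vs = []"
        using snoc.prems(2) by simp
      with snoc.prems(1) have us: "list_all2 (serves (Suc n)) us \<tau>" "serves (Suc n) c r"
        by (auto simp: list_all2_append2 list_all2_Cons2 append_eq_append_conv2 Cons_eq_append_conv)
      obtain \<pi> where \<tau>: "\<tau> = \<pi> @ hist ?s"
        using hist_suffix by (auto simp: suffix_def)
      with us(1) obtain xs ys where xy: "us = xs @ ys" "list_all2 (serves (Suc n)) ys (hist ?s)"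
        by (metis list_all2_append2)
      then obtain y ys' where ys: "ys = y # ys'"
        using False by (cases ys) (auto simp: hist_eq_Nil_iff)
      \<comment> \<open>The part \<open>ys\<close> serves the phase that ends and \<open>c\<close>
        the request that ends it. The induction hypothesis pays for earlier phases up to
        \<open>y\<close>, the only configuration shared by the two paths, so their costs add
        up.\<close>
      have "w n \<le> path_cost (Suc n) w (ys @ [c])"
        using xy(2) us(2) by (intro path_cost_or_cheap[OF _ w_nonneg not_cheap] list_all2_appendI) auto
      moreover have "phases ?s * w n \<le> path_cost (Suc n) w (xs @ [y])"
        using xy ys us(1) list_all2_lengthD[OF xy(2)] by (intro snoc.IH[of xs y ys']) auto
      ultimately show ?thesis
        using path_cost_append[of "Suc n" w xs y "ys' @ [c]"] s' xy ys
        by (simp add: algebra_simps)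
    qed
  qed
qed simp

lemma solves_alg:
  assumes "w n \<le> W"
  shows "solves (Suc n) w W ((amp n + 1) * ((n + 1) + G * ((n + 1) * (amp n + 1) + 1))) alg"
  unfolding solves_def
proof (intro allI impI conjI)
  fix \<tau> :: "(nat \<Rightarrow> 'a) list" and cs
  assume cs: "list_all2 (serves (Suc n)) cs \<tau>"
  let ?s = "state \<tau>"
  have nonneg: "0 \<le> w i" if "i < Suc n" for i
    using that w_nonneg by simp
  show "serves (Suc n) (alg \<tau>) (last \<tau>)" if "\<tau> \<noteq> []"
    using that by (rule alg_serves)
  have opt: "phases ?s * w n \<le> path_cost (Suc n) w cs"
  proof (cases "\<tau> = []")
    case True
    then show ?thesis using path_cost_nonneg[OF nonneg] by simp
  next
    case False
    obtain \<pi> where \<tau>: "\<tau> = \<pi> @ hist ?s"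
      using hist_suffix by (auto simp: suffix_def)
    with cs obtain xs ys where xy: "cs = xs @ ys" "list_all2 (serves (Suc n)) ys (hist ?s)"
      by (metis list_all2_append2)
    then obtain y ys' where ys: "ys = y # ys'"
      using False by (cases ys) (auto simp: hist_eq_Nil_iff)
    have "phases ?s * w n \<le> path_cost (Suc n) w (xs @ [y])"
      using xy ys cs list_all2_lengthD[OF xy(2)] by (intro offline_cost[of xs y ys']) auto
    also have "\<dots> \<le> path_cost (Suc n) w cs"
      unfolding xy ys by (rule path_cost_subseq[OF _ nonneg]) auto
    finally show ?thesis .
  qed
  have charge: "charge = ((n + 1) + G * ((n + 1) * (amp n + 1) + 1)) * w n"
    by (simp add: charge_def budget_def algebra_simps)
  have charge_nonneg: "0 \<le> charge"
    using w_nonneg[of n] G_nonneg budget_ge(1) by (simp add: charge_def)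
  have "schedule_cost (Suc n) (udist w) (alg []) (run alg \<tau>) \<le>
      (phases ?s * (amp n + 1) + card (used ?s)) * charge + G * (budget + w n)"
    using alg_cost[of \<tau>] f_cost_cheap[OF cheap_seg[of \<tau>]] by linarith
  \<comment> \<open>The current segment costs at most one more \<open>charge\<close>, so the
    unfinished phase counts as a full one; the additive term \<open>W\<close> pays for it.\<close>
  also have "\<dots> \<le> (phases ?s * (amp n + 1) + amp n) * charge + charge"
    using card_used[of \<tau>] charge_nonneg w_nonneg[of n]
    by (intro add_mono mult_right_mono) (auto simp: charge_def)
  also have "\<dots> = (amp n + 1) * ((n + 1) + G * ((n + 1) * (amp n + 1) + 1)) * (phases ?s * w n + w n)"
    unfolding charge by (simp add: algebra_simps)
  also have "\<dots> \<le> (amp n + 1) * ((n + 1) + G * ((n + 1) * (amp n + 1) + 1)) * (path_cost (Suc n) w cs + W)"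
    using opt assms G_nonneg by (intro mult_left_mono add_mono) auto
  finally show "schedule_cost (Suc n) (udist w) (alg []) (run alg \<tau>) \<le>
      (amp n + 1) * ((n + 1) + G * ((n + 1) * (amp n + 1) + 1)) * (path_cost (Suc n) w cs + W)"
    by simp
qed

end

section \<open>Growth of the ratio and induction on the number of servers\<close>

text \<open>To be read with \<open>x = 2 ^ 2 ^ n\<close>, \<open>a = amp n + 1\<close>,
  \<open>b = n + 1\<close> and ratio \<open>x ^ 4\<close> for \<open>n\<close> servers. One more
  server squares \<open>x\<close>, so the target is \<open>x ^ 8\<close>; the leading term is only
  \<open>x ^ 7\<close>, and the spare factor absorbs the rest.\<close>

lemma ratio_step:
  fixes x a b :: real
  assumes "2 \<le> x" "0 \<le> a" "a \<le> x" "0 \<le> b" "b \<le> x"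
  shows "a * (b + x ^ 4 * (b * a + 1)) \<le> x ^ 8"
proof -
  have "a * (b + x ^ 4 * (b * a + 1)) \<le> x * (x + x ^ 4 * (x * x + 1))"
    using assms by (intro mult_mono add_mono mult_nonneg_nonneg add_nonneg_nonneg) auto
  also have "\<dots> = x ^ 2 + x ^ 5 + x ^ 7"
    by (simp add: algebra_simps power_numeral_reduce)
  also have "\<dots> \<le> x ^ 6 + x ^ 6 + x ^ 7"
    using assms by (intro add_mono power_increasing) auto
  also have "\<dots> = 2 * x ^ 6 + x ^ 7"
    by simp
  also have "\<dots> \<le> x * x ^ 6 + x ^ 7"
    using assms by (intro add_mono mult_right_mono) auto
  also have "\<dots> = 2 * x ^ 7"
    by (simp add: power_numeral_reduce)
  also have "\<dots> \<le> x * x ^ 7"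
    using assms by (intro mult_right_mono) auto
  finally show ?thesis by (simp add: power_numeral_reduce)
qed

lemma solves_mono:
  fixes f :: "'a online_alg"
  assumes "solves n w W G f" "G \<le> H" "0 \<le> W" "\<And>i. i < n \<Longrightarrow> 0 \<le> w i"
  shows "solves n w W H f"
  unfolding solves_def
proof (intro allI impI conjI)
  fix \<tau> :: "(nat \<Rightarrow> 'a) list" and cs assume cs: "list_all2 (serves n) cs \<tau>"
  with assms(1) show "serves n (f \<tau>) (last \<tau>)" if "\<tau> \<noteq> []"
    using that by (simp add: solves_def)
  have "schedule_cost n (udist w) (f []) (run f \<tau>) \<le> G * (path_cost n w cs + W)"
    using assms(1) cs by (simp add: solves_def)
  also have "\<dots> \<le> H * (path_cost n w cs + W)"
    using assms path_cost_nonneg[of n w cs] by (intro mult_right_mono) auto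
  finally show "schedule_cost n (udist w) (f []) (run f \<tau>) \<le> H * (path_cost n w cs + W)" .
qed

lemma solves_exists:
  assumes "\<And>i j. i \<le> j \<Longrightarrow> j < n \<Longrightarrow> w i \<le> w j" "\<And>i. i < n \<Longrightarrow> 0 < w i"
    and "\<And>i. i < n \<Longrightarrow> w i \<le> W" "0 \<le> W"
  shows "\<exists>f :: 'a online_alg. solves n w W (2 ^ (4 * 2 ^ n)) f"
  using assms
proof (induction n arbitrary: W)
  case 0
  have "list_all2 (serves 0) cs \<tau> \<longleftrightarrow> cs = [] \<and> \<tau> = []" for cs \<tau> :: "(nat \<Rightarrow> 'a) list"
    by (cases cs; cases \<tau>) (auto simp: serves_def)
  then show ?case
    using 0 by (intro exI[of _ undefined]) (auto simp: solves_def)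
next
  case (Suc n)
  define x :: real where "x = 2 ^ 2 ^ n"
  \<comment> \<open>For the lighter servers the additive term is set by the weight of the server
    being added.\<close>
  have "\<exists>f :: 'a online_alg. solves n w (w n) (2 ^ (4 * 2 ^ n)) f"
    using Suc.prems(1,2) by (intro Suc.IH) (auto intro: less_imp_le)
  then obtain f :: "'a online_alg" where f: "solves n w (w n) (x ^ 4) f"
    unfolding x_def power_mult[symmetric] by (auto simp: mult.commute)
  interpret layer n w "x ^ 4" f
    using Suc.prems(1,2) f by unfold_locales (auto simp: x_def)
  have "2 \<le> x"
    unfolding x_def using power_increasing[of 1 "2 ^ n" "2 :: real"] by simp
  moreover have "real (amp n + 1) \<le> x"
  proof -
    have "amp n + 1 \<le> 2 ^ 2 ^ n"
      using amp_less[of n] by simp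
    then have "real (amp n + 1) \<le> real (2 ^ 2 ^ n)"
      by (rule of_nat_mono)
    then show ?thesis by (simp add: x_def)
  qed
  moreover have "real (n + 1) \<le> x"
  proof -
    have "n + 1 \<le> 2 ^ n" "(2::nat) ^ n \<le> 2 ^ 2 ^ n"
      by (auto intro: power_increasing less_imp_le simp: Suc_le_eq)
    then have "real (n + 1) \<le> real (2 ^ 2 ^ n)"
      by (intro of_nat_mono) (rule order_trans)
    then show ?thesis by (simp add: x_def)
  qed
  ultimately have "(amp n + 1) * ((n + 1) + x ^ 4 * ((n + 1) * (amp n + 1) + 1)) \<le> x ^ 8"
    using ratio_step[of x "amp n + 1" "n + 1"] by (simp add: algebra_simps)
  moreover have "x ^ 8 = 2 ^ (4 * 2 ^ Suc n)"
    by (simp add: x_def flip: power_mult)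
  moreover have "w n \<le> W"
    using Suc.prems(3) by simp
  ultimately have "solves (Suc n) w W (2 ^ (4 * 2 ^ Suc n)) alg"
    using solves_mono[OF solves_alg[of W], of "2 ^ (4 * 2 ^ Suc n)"] Suc.prems(2,4)
    by (simp add: less_imp_le)
  then show ?case by blast
qed

section \<open>Sorting the weights and returning to the given metric spaces\<close>

lemma sorting_permutation:
  fixes w :: "nat \<Rightarrow> real"
  shows "\<exists>\<pi>. bij_betw \<pi> {..<k} {..<k} \<and> (\<forall>i j. i \<le> j \<longrightarrow> j < k \<longrightarrow> w (\<pi> i) \<le> w (\<pi> j))"
proof -
  define xs where "xs = sort_key w [0..<k]"
  have "bij_betw ((!) xs) {..<k} {..<k}"
    by (rule bij_betw_nth) (auto simp: xs_def)
  moreover have "w (xs ! i) \<le> w (xs ! j)" if "i \<le> j" "j < k" for i j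
  proof -
    have "sorted (map w xs)"
      by (simp add: xs_def)
    moreover have "length xs = k"
      by (simp add: xs_def)
    ultimately show ?thesis
      using that sorted_nth_mono[of "map w xs" i j] by simp
  qed
  ultimately show ?thesis by blast
qed

lemma uniform_dist_eq:
  assumes "uniform_metric_space X d a" "x \<in> X" "y \<in> X"
  shows "d x y = (if x = y then 0 else a)"
  using assms Metric_space.zero[of X d x y] by (auto simp: uniform_metric_space_def)

lemma schedule_cost_udist:
  assumes "\<And>i. i < k \<Longrightarrow> uniform_metric_space (M i) (d i) (w i)"
    and "c \<in> configs k M" "cs \<in> lists (configs k M)"
  shows "schedule_cost k d c cs = schedule_cost k (udist w) c cs"
  using assms(2,3)
proof (induction cs arbitrary: c)
  case (Cons a cs)
  then have "d i (c i) (a i) = udist w i (c i) (a i)" if "i < k" for i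
    using that uniform_dist_eq[OF assms(1)[OF that]]
    by (auto simp: udist_def configs_def PiE_iff)
  then have "move_cost k d c a = move_cost k (udist w) c a"
    by (simp add: move_cost_def)
  with Cons show ?case by simp
qed simp

theorem theorem3:
  fixes k :: nat
    and M :: "nat \<Rightarrow> 'a set"
    and d :: "nat \<Rightarrow> 'a \<Rightarrow> 'a \<Rightarrow> real"
    and w :: "nat \<Rightarrow> real"
    and c0 :: "nat \<Rightarrow> 'a"
  assumes "1 \<le> k"
    and "\<And>i. i < k \<Longrightarrow> uniform_metric_space (M i) (d i) (w i)"
    and "c0 \<in> configs k M"
  shows "\<exists>A. valid_online_alg k M A \<and> competitive k M d c0 (2 ^ 2 ^ (k + 3)) A"
proof -
  obtain \<pi> where \<pi>: "bij_betw \<pi> {..<k} {..<k}"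
      and sorted: "\<And>i j. i \<le> j \<Longrightarrow> j < k \<Longrightarrow> w (\<pi> i) \<le> w (\<pi> j)"
    using sorting_permutation by blast
  define v where "v = w \<circ> \<pi>"
  have w_pos: "0 < w i" if "i < k" for i
    using assms(2)[OF that] by (simp add: uniform_metric_space_def)
  have \<pi>_less: "\<pi> i < k" if "i < k" for i
    using that \<pi> by (auto simp: bij_betw_def)
  have v_pos: "0 < v i" if "i < k" for i
    using w_pos[OF \<pi>_less[OF that]] by (simp add: v_def)
  define W where "W = v (k - 1)"
  define C :: real where "C = 2 ^ (4 * 2 ^ k)"
  have W: "0 < W"
    using v_pos assms(1) by (simp add: W_def)
  have "\<exists>f :: 'a online_alg. solves k v W C f"
    unfolding C_def
  proof (rule solves_exists)
    show "v i \<le> W" if "i < k" for i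
      using that sorted[of i "k - 1"] by (simp add: v_def W_def)
  qed (use sorted v_pos W in \<open>auto simp: v_def\<close>)
  then obtain f :: "'a online_alg" where f: "solves k v W C f" by blast
  \<comment> \<open>\<open>g\<close> undoes the sorting and replaces points outside the carriers by
    those of \<open>c0\<close>. Equal points stay equal, so no move gets dearer, and a server at a
    requested point stays there.\<close>
  define g where "g = (\<lambda>c. \<lambda>i\<in>{..<k}. let x = c (inv_into {..<k} \<pi> i) in if x \<in> M i then x else c0 i)"
  define A where "A = (\<lambda>\<sigma>. g (f (map (\<lambda>r. r \<circ> \<pi>) \<sigma>)))"
  have g_config: "g c \<in> configs k M" for c
    using assms(3) by (simp add: g_def configs_def PiE_iff Let_def)
  have run_A: "run A \<sigma> = map g (run f (map (\<lambda>r. r \<circ> \<pi>) \<sigma>))" for \<sigma>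
    by (simp add: run_def A_def take_map)
  have w_nonneg: "0 \<le> w i" if "i < k" for i
    using w_pos[OF that] by simp
  have move_perm: "move_cost k (udist w) c c' = move_cost k (udist v) (c \<circ> \<pi>) (c' \<circ> \<pi>)"
    for c c' :: "nat \<Rightarrow> 'a"
    unfolding move_cost_def using sum.reindex_bij_betw[OF \<pi>, of "\<lambda>i. udist w i (c i) (c' i)"]
    by (simp add: udist_def v_def o_def)
  have schedule_perm: "schedule_cost k (udist w) c cs =
      schedule_cost k (udist v) (c \<circ> \<pi>) (map (\<lambda>c. c \<circ> \<pi>) cs)" for c and cs :: "(nat \<Rightarrow> 'a) list"
    by (induction cs arbitrary: c) (simp_all add: move_perm)
  have inv: "inv_into {..<k} \<pi> (\<pi> i) = i" if "i < k" for i
    using \<pi> that by (simp add: bij_betw_def)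
  have move_g: "move_cost k (udist w) (g c) (g c') \<le> move_cost k (udist v) c c'" for c c'
  proof -
    have "udist v i (g c (\<pi> i)) (g c' (\<pi> i)) \<le> udist v i (c i) (c' i)" if "i < k" for i
      using v_pos[OF that] that by (simp add: g_def Let_def \<pi>_less inv udist_def)
    then show ?thesis
      unfolding move_perm by (auto simp: move_cost_def intro!: sum_mono)
  qed
  have schedule_g: "schedule_cost k (udist w) (g c) (map g cs) \<le> schedule_cost k (udist v) c cs" for c cs
    by (induction cs arbitrary: c) (auto intro!: add_mono move_g)
  have serves_perm: "serves k (c \<circ> \<pi>) (r \<circ> \<pi>) \<longleftrightarrow> serves k c r" for c r :: "nat \<Rightarrow> 'a"
  proof -
    have "(\<exists>i\<in>\<pi> ` {..<k}. c i = r i) \<longleftrightarrow> (\<exists>i\<in>{..<k}. c i = r i)"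
      using \<pi> by (simp add: bij_betw_def)
    then show ?thesis by (auto simp: serves_def)
  qed
  have serves_g: "serves k (g c) r" if "serves k c (r \<circ> \<pi>)" "r \<in> configs k M" for c r
  proof -
    obtain i where "i < k" "c i = r (\<pi> i)"
      using \<open>serves k c (r \<circ> \<pi>)\<close> by (auto simp: serves_def)
    then have "g c (\<pi> i) = r (\<pi> i)"
      using that(2) \<pi>_less inv by (simp add: g_def configs_def PiE_iff)
    then show ?thesis using \<open>i < k\<close> \<pi>_less by (auto simp: serves_def)
  qed
  have list_all2_perm: "list_all2 (serves k) (map (\<lambda>c. c \<circ> \<pi>) cs) (map (\<lambda>r. r \<circ> \<pi>) \<sigma>) \<longleftrightarrow>
      list_all2 (serves k) cs \<sigma>" for cs \<sigma> :: "(nat \<Rightarrow> 'a) list"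
    by (simp add: list_all2_map1 list_all2_map2 serves_perm)
  \<comment> \<open>Copying the requests is always feasible as \<open>0 < k\<close>; this activates
    the serving guarantee of \<open>solves\<close> and makes the set behind the infimum
    nonempty.\<close>
  have self: "list_all2 (serves k) \<sigma> \<sigma>" for \<sigma> :: "(nat \<Rightarrow> 'a) list"
    using assms(1) by (auto simp: serves_def list_all2_same intro!: exI[of _ 0])
  have valid: "valid_online_alg k M A"
    unfolding valid_online_alg_def feasible_schedule_def
  proof (intro ballI conjI)
    fix \<sigma> assume \<sigma>: "\<sigma> \<in> lists (configs k M)"
    show "run A \<sigma> \<in> lists (configs k M)"
      using g_config by (auto simp: run_A)
    have "serves k (A (take (Suc t) \<sigma>)) (\<sigma> ! t)" if t: "t < length \<sigma>" for t
    proof -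
      let ?\<tau> = "map (\<lambda>r. r \<circ> \<pi>) (take (Suc t) \<sigma>)"
      have "?\<tau> \<noteq> []" using t by auto
      then have "serves k (f ?\<tau>) (last ?\<tau>)"
        using f self[of ?\<tau>] unfolding solves_def by blast
      moreover have "last ?\<tau> = \<sigma> ! t \<circ> \<pi>"
        using t by (simp add: take_Suc_conv_app_nth)
      moreover have "\<sigma> ! t \<in> configs k M"
        using \<sigma> t by auto
      ultimately show ?thesis
        using serves_g by (simp add: A_def)
    qed
    then show "list_all2 (serves k) (run A \<sigma>) \<sigma>"
      by (simp add: list_all2_conv_all_nth run_def)
  qed
  have "competitive k M d c0 (2 ^ 2 ^ (k + 3)) A"
    unfolding competitive_def
  proof (intro exI ballI)
    fix \<sigma> assume \<sigma>: "\<sigma> \<in> lists (configs k M)"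
    \<comment> \<open>The move from \<open>c0\<close> to the starting configuration of
      \<open>A\<close>, plus the additive term of \<open>solves\<close>; neither depends on
      \<open>\<sigma>\<close>.\<close>
    define a where "a = move_cost k (udist w) c0 (A []) + C * W"
    define D :: real where "D = 2 ^ 2 ^ (k + 3)"
    have "(4::nat) * 2 ^ k \<le> 2 ^ (k + 3)"
      by (simp add: power_add)
    then have CD: "0 < C" "C \<le> D"
      unfolding C_def D_def by (auto intro!: power_increasing)
    have bound: "schedule_cost k d c0 (run A \<sigma>) \<le> D * schedule_cost k d c0 cs + a"
      if cs: "feasible_schedule k M \<sigma> cs" for cs
    proof -
      let ?\<sigma> = "map (\<lambda>r. r \<circ> \<pi>) \<sigma>" and ?cs = "map (\<lambda>c. c \<circ> \<pi>) cs"
      have cs': "cs \<in> lists (configs k M)" "list_all2 (serves k) cs \<sigma>"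
        using cs by (auto simp: feasible_schedule_def)
      have "schedule_cost k d c0 (run A \<sigma>) = schedule_cost k (udist w) c0 (run A \<sigma>)"
        using valid \<sigma> schedule_cost_udist[where M = M and d = d, OF assms(2,3)]
        by (simp add: valid_online_alg_def feasible_schedule_def)
      also have "\<dots> \<le> schedule_cost k (udist w) c0 (A [] # run A \<sigma>)"
        by (rule schedule_cost_subseq) (auto intro: w_nonneg)
      also have "\<dots> = move_cost k (udist w) c0 (A []) + schedule_cost k (udist w) (A []) (run A \<sigma>)"
        by simp
      also have "schedule_cost k (udist w) (A []) (run A \<sigma>) \<le> schedule_cost k (udist v) (f []) (run f ?\<sigma>)"
        unfolding run_A by (simp add: A_def schedule_g)
      also have "\<dots> \<le> C * (path_cost k v ?cs + W)"
        using f cs'(2) list_all2_perm[of cs \<sigma>] unfolding solves_def by blast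
      \<comment> \<open>The free start saves the first move away from \<open>c0\<close>.\<close>
      also have "path_cost k v ?cs \<le> schedule_cost k (udist v) (c0 \<circ> \<pi>) ?cs"
        using move_cost_nonneg[of k v "c0 \<circ> \<pi>"] v_pos
        by (cases cs) (auto simp: less_imp_le)
      also have "\<dots> = schedule_cost k d c0 cs"
        using schedule_cost_udist[where M = M and d = d, OF assms(2,3) cs'(1)] schedule_perm by simp
      finally have "schedule_cost k d c0 (run A \<sigma>) \<le> C * schedule_cost k d c0 cs + a"
        using CD(1) by (simp add: a_def algebra_simps)
      moreover have "0 \<le> schedule_cost k d c0 cs"
        using schedule_cost_udist[where M = M and d = d, OF assms(2,3) cs'(1)]
          schedule_cost_nonneg[of k w] w_nonneg by simp
      ultimately show ?thesis
        using mult_right_mono[OF CD(2), of "schedule_cost k d c0 cs"] by linarith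
    qed
    \<comment> \<open>Dividing by \<open>D\<close> turns the bound for every schedule into a lower
      bound for the infimum.\<close>
    have "(schedule_cost k d c0 (run A \<sigma>) - a) / D \<le> opt_cost k M d c0 \<sigma>"
      unfolding opt_cost_def
    proof (rule cInf_greatest)
      show "{schedule_cost k d c0 cs |cs. feasible_schedule k M \<sigma> cs} \<noteq> {}"
        using \<sigma> self by (auto simp: feasible_schedule_def)
      show "(schedule_cost k d c0 (run A \<sigma>) - a) / D \<le> x"
        if "x \<in> {schedule_cost k d c0 cs |cs. feasible_schedule k M \<sigma> cs}" for x
        using that bound CD by (auto simp: field_simps)
    qed
    then have "schedule_cost k d c0 (run A \<sigma>) \<le> D * opt_cost k M d c0 \<sigma> + a"
      using CD by (simp add: field_simps)
    then show "schedule_cost k d c0 (run A \<sigma>) \<le> 2 ^ 2 ^ (k + 3) * opt_cost k M d c0 \<sigma> +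
        (move_cost k (udist w) c0 (A []) + C * W)"
      by (simp add: a_def D_def)
  qed
  with valid show ?thesis by blast
qed

end
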